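(* For every integer $n\ge 1$ let $f(n)=\dfrac{(1/2)^n+(-1)^n}{n}$. Then for all integers $n\ge 4$, $$\frac{(n-2)f(n-2)+(n-3)f(n-3)}{n f(n)+(n-1)f(n-1)}=4.$$ *)

theory Defs
  imports Complex_Main
begin

end

theory Submission
  imports Defs
begin

text \<open>
  Multiplying by \<open>n\<close> clears the denominator of \<open>f n\<close> and leaves \<open>(1/2)^n + (-1)^n\<close>. In the sum of two
  consecutive such terms the alternating parts cancel, and what remains is the geometric sequence
  \<open>3 (1/2)^n\<close>. The numerator is this sequence two places before the denominator, so the quotient is
  \<open>(1/2)^(-2) = 4\<close>.
\<close>

lemma consecutive_powi_sum:
  fixes n :: int
  shows "((1/2) powi n + (-1) powi n) + ((1/2) powi (n - 1) + (-1) powi (n - 1)) =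
    (3 * (1/2) powi n :: real)"
  by (simp add: power_int_diff)

theorem mainTheorem1:
  fixes f :: "int \<Rightarrow> real"
  assumes f: "\<And>n::int. n \<ge> 1 \<Longrightarrow> f n = ((1/2) powi n + (-1) powi n) / of_int n"
  shows "\<forall>n::int. n \<ge> 4 \<longrightarrow>
    (of_int (n - 2) * f (n - 2) + of_int (n - 3) * f (n - 3)) /
    (of_int n * f n + of_int (n - 1) * f (n - 1)) = 4"
proof (intro allI impI)
  fix n :: int
  assume n: "n \<ge> 4"
  have cleared: "of_int m * f m = (1/2) powi m + (-1) powi m" if "m \<ge> 1" for m
    using that by (simp add: f)
  have pair: "of_int m * f m + of_int (m - 1) * f (m - 1) = 3 * (1/2) powi m" if "m \<ge> 2" for m
  proof -
    have "m \<ge> 1" "m - 1 \<ge> 1" using that by auto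
    then show ?thesis by (simp only: cleared consecutive_powi_sum)
  qed
  have num: "of_int (n - 2) * f (n - 2) + of_int (n - 3) * f (n - 3) = 3 * (1/2) powi (n - 2)"
    using pair[of "n - 2"] n by simp
  have den: "of_int n * f n + of_int (n - 1) * f (n - 1) = 3 * (1/2) powi n"
    using n by (intro pair) simp
  have "(1/2) powi (n - 2) = (4 * (1/2) powi n :: real)"
    by (simp add: power_int_diff power2_eq_square)
  then show "(of_int (n - 2) * f (n - 2) + of_int (n - 3) * f (n - 3)) /
    (of_int n * f n + of_int (n - 1) * f (n - 1)) = 4"
    unfolding num den by simp
qed

end
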